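(* Let $\mu>0$, let $n\ge 2$ be an integer, let $\beta=\frac1n$, let $D_\mu$ be the tempered $\beta$-stable subordinator with tempering parameter $\mu$, and let $m_\mu(x,t)$ be the density function of its first-exit time $\inf\{x>0: D_\mu(x)>t\}$. Then $m_\mu$ satisfies the PDE $$\sum_{j=1}^{n}(-1)^j \binom{n}{j}\, \mu^{1-j/n}\,\frac{\partial^j}{\partial x^j}m_{\mu}(x,t) = \frac{\partial}{\partial t}m_{\mu}(x,t)+\delta_0(t)\,m_{\mu}(x,0),$$ where $\delta_0(t)$ is the Dirac delta function.
   Context: For $0<\beta<1$ let $f(x,t)$ be the density of the $\beta$-stable subordinator, i.e. $\int_0^\infty e^{-sx}f(x,t)\,dx=e^{-ts^\beta}$. The tempered stable subordinator $D_\mu(t)$ is the subordinator with density $f_\mu(x,t)=e^{-\mu x+\mu^\beta t}f(x,t)$, $x>0$, so that $\int_0^\infty e^{-sx}f_\mu(x,t)\,dx=e^{-t((s+\mu)^\beta-\mu^\beta)}$; its sample paths are strictly increasing. The variable $x>0$ is the space variable (value of the first-exit time) and $t$ the level. The term with $\delta_0(t)$ is understood through the Laplace transform in $t$, with the conventions $\mathcal{L}_t(\delta_0(t))=1$ and $\mathcal{L}_t(\partial m_\mu/\partial t)=s\,\mathcal{L}_t m_\mu-m_\mu(x,0)$. *)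

theory Defs
  imports "HOL-Probability.Probability"
begin

locale subordinator = prob_space M for M :: "'a measure" +
  fixes D :: "real \<Rightarrow> 'a \<Rightarrow> real"
  assumes random_variable_D: "\<And>t. t \<ge> 0 \<Longrightarrow> random_variable borel (D t)"
    and start_zero: "AE \<omega> in M. D 0 \<omega> = 0"
    and independent_increments:
      "\<And>(\<tau> :: nat \<Rightarrow> real) k. 0 \<le> \<tau> 0 \<Longrightarrow> strict_mono_on {..k} \<tau> \<Longrightarrow>
         indep_vars (\<lambda>_. borel) (\<lambda>i \<omega>. D (\<tau> (Suc i)) \<omega> - D (\<tau> i) \<omega>) {..<k}"
    and stationary_increments:
      "\<And>r t. 0 \<le> r \<Longrightarrow> r < t \<Longrightarrow>
         distr M borel (\<lambda>\<omega>. D t \<omega> - D r \<omega>) = distr M borel (D (t - r))"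
    and nondecreasing_paths: "AE \<omega> in M. mono_on {0..} (\<lambda>t. D t \<omega>)"
    and right_continuous_paths:
      "AE \<omega> in M. \<forall>t\<ge>0. continuous (at_right t) (\<lambda>u. D u \<omega>)"

text \<open>The Laplace transform determines \<open>f(\<cdot>, t)\<close> up to a null set; \<open>s = 0\<close> says that it
  has total mass 1.\<close>

definition stable_density :: "real \<Rightarrow> (real \<Rightarrow> real \<Rightarrow> real) \<Rightarrow> bool" where
  "stable_density \<beta> f \<longleftrightarrow>
     (\<forall>t>0. (\<lambda>x. f x t) \<in> borel_measurable borel \<and> (\<forall>x>0. 0 \<le> f x t) \<and>
       (\<forall>s\<ge>0. set_integrable lborel {0<..} (\<lambda>x. exp (- s * x) * f x t) \<and>
          set_lebesgue_integral lborel {0<..} (\<lambda>x. exp (- s * x) * f x t) =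
            exp (- t * s powr \<beta>)))"

definition tempered_density :: "real \<Rightarrow> real \<Rightarrow> (real \<Rightarrow> real \<Rightarrow> real) \<Rightarrow> real \<Rightarrow> real \<Rightarrow> real" where
  "tempered_density \<mu> \<beta> f x t = exp (- \<mu> * x + \<mu> powr \<beta> * t) * f x t"

definition tempered_stable_subordinator ::
    "'a measure \<Rightarrow> (real \<Rightarrow> 'a \<Rightarrow> real) \<Rightarrow> real \<Rightarrow> real \<Rightarrow> bool" where
  "tempered_stable_subordinator M D \<mu> \<beta> \<longleftrightarrow>
     subordinator M D \<and>
     (\<exists>f. stable_density \<beta> f \<and>
        (\<forall>t>0. distributed M lborel (D t)
           (\<lambda>x. ennreal (tempered_density \<mu> \<beta> f x t) * indicator {0<..} x)))"

definition first_exit :: "(real \<Rightarrow> 'a \<Rightarrow> real) \<Rightarrow> real \<Rightarrow> 'a \<Rightarrow> real" where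
  "first_exit D t \<omega> = Inf {x. x > 0 \<and> D x \<omega> > t}"

text \<open>A density is unique only up to null sets. As the equation involves derivatives of
  \<open>m\<close> in the space variable, \<open>m(\<cdot>, t)\<close> denotes the continuous version on \<open>(0, \<infinity>)\<close>, which is
  unique; no differentiability, and no regularity in \<open>t\<close>, is required. The law of the first
  exit time of the level 0 is the point mass at 0, which has no density, so \<open>m(x, 0)\<close> denotes
  the initial value \<open>m(x, 0+)\<close>. The equation with \<open>Lim\<close> only fixes this notation: it does not
  assert that the limit exists.\<close>

definition first_exit_density ::
    "'a measure \<Rightarrow> (real \<Rightarrow> 'a \<Rightarrow> real) \<Rightarrow> (real \<Rightarrow> real \<Rightarrow> real) \<Rightarrow> bool" where
  "first_exit_density M D m \<longleftrightarrow>
     (\<forall>t>0. (\<forall>x>0. 0 \<le> m x t) \<and> continuous_on {0<..} (\<lambda>x. m x t) \<and>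
        distributed M lborel (first_exit D t) (\<lambda>x. ennreal (m x t) * indicator {0<..} x)) \<and>
     (\<forall>x>0. m x 0 = Lim (at_right 0) (m x))"

definition partial_x :: "nat \<Rightarrow> (real \<Rightarrow> real \<Rightarrow> real) \<Rightarrow> real \<Rightarrow> real \<Rightarrow> real" where
  "partial_x j m x t = (deriv ^^ j) (\<lambda>y. m y t) x"

definition partial_t :: "(real \<Rightarrow> real \<Rightarrow> real) \<Rightarrow> real \<Rightarrow> real \<Rightarrow> real" where
  "partial_t m x t = deriv (m x) t"

text \<open>Laplace transform of the measure \<open>g dN\<close> on \<open>[0, \<infinity>)\<close>. An ordinary function \<open>g\<close> of \<open>t\<close> is
  transformed with \<open>N = lborel\<close>, and \<open>\<delta>\<^sub>0(t) c\<close> with \<open>N = return borel 0\<close> and \<open>g\<close> the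
  constant \<open>c\<close>. The point 0 must therefore belong to the domain of integration.\<close>

definition laplace_integrable :: "real measure \<Rightarrow> (real \<Rightarrow> real) \<Rightarrow> real \<Rightarrow> bool" where
  "laplace_integrable N g s \<longleftrightarrow> set_integrable N {0..} (\<lambda>t. exp (- s * t) * g t)"

definition laplace :: "real measure \<Rightarrow> (real \<Rightarrow> real) \<Rightarrow> real \<Rightarrow> real" where
  "laplace N g s = set_lebesgue_integral N {0..} (\<lambda>t. exp (- s * t) * g t)"

abbreviation dirac_delta :: "real measure" where
  "dirac_delta \<equiv> return borel 0"

lemma laplace_dirac_delta: "laplace dirac_delta (\<lambda>t. c) s = c"
  unfolding laplace_def set_lebesgue_integral_def by (subst integral_return) auto

end

theory Submission
  imports Defs "HOL-Complex_Analysis.Conformal_Mappings"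
begin

text \<open>
  By analytic continuation of its Laplace transform, \<open>D x\<close> has the characteristic function
  \<open>exp (- x \<psi>(\<xi>))\<close> with \<open>\<psi>(\<xi>) = (\<mu> - \<i>\<xi>) powr (1/n) - \<mu> powr (1/n)\<close>
  (\<open>stable_density_complex_laplace\<close>, \<open>char_tempered_stable\<close>). It decays like
  \<open>exp (- c \<bar>\<xi>\<bar> powr (1/n))\<close>, so Levy's inversion formula holds with an absolutely convergent
  integral. For \<open>-1 \<le> t\<close> it reads
  \<open>P(D x \<le> t) = H 0 x t\<close>, where
  \<open>H k x t = 1/(2\<pi>) \<integral> Re (\<kappa> t \<xi> * \<psi>(\<xi>)^k * exp (- x \<psi>(\<xi>))) d\<xi>\<close> and \<open>\<kappa> t \<xi>\<close> is the integral of
  \<open>exp (- \<i>\<xi>u)\<close> over \<open>-1 \<le> u \<le> t\<close> (\<open>tempered_stable_cdf\<close>).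

  Paths are nondecreasing and right-continuous, so almost surely the level \<open>t\<close> is first exceeded
  later than \<open>x\<close> iff \<open>D x \<le> t\<close>. The first-exit time therefore has the tail \<open>x \<mapsto> H 0 x t\<close>, and
  its continuous density is minus the derivative: \<open>m x t = H 1 x t\<close>
  (\<open>first_exit_density_eq_H\<close>). Each derivative in \<open>x\<close> brings down one more factor \<open>- \<psi>\<close>, and the
  derivative in \<open>t\<close> replaces \<open>\<kappa> t \<xi>\<close> by \<open>exp (- \<i>\<xi>t)\<close>.

  The differential equation is the binomial theorem under the integral sign: with
  \<open>r = \<mu> powr (1/n)\<close>, the sum over \<open>j = 1..n\<close> of \<open>(n choose j) r^(n-j) \<psi>^j\<close> is
  \<open>(\<psi> + r)^n - r^n = - \<i>\<xi>\<close>, and \<open>- \<i>\<xi> \<kappa> t \<xi> = exp (- \<i>\<xi>t) - exp (\<i>\<xi>)\<close>. The left-hand side of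
  the equation is thus \<open>\<partial>m/\<partial>t\<close> at the level \<open>t\<close> minus the same integral at the level \<open>-1\<close>
  (\<open>H_equation\<close>). The latter vanishes, because everything is zero at negative levels, which the
  positive process \<open>D\<close> exceeds at once (\<open>J_boundary_eq_0\<close>).

  For the same reason \<open>m x 0 = H 1 x 0 = 0\<close>, so that the term with the Dirac measure contributes
  nothing. From \<open>\<bar>\<kappa> t \<xi>\<bar> \<le> 1 + t\<close> all functions involved grow at most linearly in \<open>t\<close>; hence
  their Laplace transforms exist for every \<open>s > 0\<close>, the transform of \<open>\<partial>m/\<partial>t\<close> comes from
  integration by parts, and the transformed equation from integrating the pointwise one.
\<close>

section \<open>Differentiation under the integral sign and integrable bounds\<close>

text \<open>By the mean value inequality, \<open>B\<close> also dominates the difference quotients, which makes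
  dominated convergence applicable. The field is arbitrary because holomorphy of a Laplace
  transform needs it over \<open>\<complex>\<close>, and the derivatives of the Fourier integrals over \<open>\<real>\<close>.\<close>

lemma has_field_derivative_integral:
  fixes F F' :: "'b::{real_normed_field, banach, second_countable_topology} \<Rightarrow> 'a \<Rightarrow> 'b"
  assumes S: "open S" "convex S" "z \<in> S"
    and int: "\<And>w. w \<in> S \<Longrightarrow> integrable M (F w)"
    and deriv: "\<And>w x. w \<in> S \<Longrightarrow> x \<in> space M \<Longrightarrow> ((\<lambda>w. F w x) has_field_derivative F' w x) (at w)"
    and meas: "F' z \<in> borel_measurable M"
    and bound: "\<And>w x. w \<in> S \<Longrightarrow> x \<in> space M \<Longrightarrow> norm (F' w x) \<le> B x"
    and B: "integrable M B"
  shows "((\<lambda>w. \<integral>x. F w x \<partial>M) has_field_derivative (\<integral>x. F' z x \<partial>M)) (at z)"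
proof -
  have "((\<lambda>w. ((\<integral>x. F w x \<partial>M) - (\<integral>x. F z x \<partial>M)) / (w - z)) \<longlongrightarrow> (\<integral>x. F' z x \<partial>M))
      (at z within S)"
    unfolding tendsto_at_iff_sequentially o_def
  proof (intro allI impI)
    fix X :: "nat \<Rightarrow> 'b"
    assume XS: "\<forall>i. X i \<in> S - {z}" and X: "X \<longlonglongrightarrow> z"
    have Xi: "X i \<in> S" "X i \<noteq> z" for i
      using XS by auto
    have q_int: "integrable M (\<lambda>x. (F (X i) x - F z x) / (X i - z))" for i
      using int Xi S by auto
    have "(\<lambda>i. \<integral>x. (F (X i) x - F z x) / (X i - z) \<partial>M) \<longlonglongrightarrow> (\<integral>x. F' z x \<partial>M)"
    proof (rule integral_dominated_convergence[OF meas _ B])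
      show "(\<lambda>x. (F (X i) x - F z x) / (X i - z)) \<in> borel_measurable M" for i
        using q_int by auto
      show "AE x in M. (\<lambda>i. (F (X i) x - F z x) / (X i - z)) \<longlonglongrightarrow> F' z x"
      proof (rule AE_I2)
        fix x assume x: "x \<in> space M"
        have "((\<lambda>w. (F w x - F z x) / (w - z)) \<longlongrightarrow> F' z x) (at z)"
          using deriv[OF S(3) x] unfolding has_field_derivative_iff .
        then show "(\<lambda>i. (F (X i) x - F z x) / (X i - z)) \<longlonglongrightarrow> F' z x"
          using X Xi(2) unfolding tendsto_at_iff_sequentially o_def by blast
      qed
      show "AE x in M. norm ((F (X i) x - F z x) / (X i - z)) \<le> B x" for i
      proof (rule AE_I2)
        fix x assume x: "x \<in> space M"
        have "norm (F (X i) x - F z x) \<le> B x * norm (X i - z)"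
          by (rule field_differentiable_bound[OF S(2), where f' = "\<lambda>w. F' w x"])
             (use deriv bound x Xi S in \<open>auto intro: has_field_derivative_at_within\<close>)
        then show "norm ((F (X i) x - F z x) / (X i - z)) \<le> B x"
          using Xi(2)[of i] by (simp add: norm_divide divide_le_eq)
      qed
    qed
    also have "(\<lambda>i. \<integral>x. (F (X i) x - F z x) / (X i - z) \<partial>M) =
        (\<lambda>i. ((\<integral>x. F (X i) x \<partial>M) - (\<integral>x. F z x \<partial>M)) / (X i - z))"
      using int Xi S by simp
    finally show "(\<lambda>i. ((\<integral>x. F (X i) x \<partial>M) - (\<integral>x. F z x \<partial>M)) / (X i - z)) \<longlonglongrightarrow>
        (\<integral>x. F' z x \<partial>M)" .
  qed
  then show ?thesis
    unfolding has_field_derivative_iff at_within_open[OF S(3,1)] .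
qed

lemma power_le_exp:
  fixes u c :: real
  assumes "0 \<le> u" "0 < c"
  shows "u ^ N \<le> fact N / c ^ N * exp (c * u)"
proof -
  have "(c * u) ^ N / fact N \<le> exp (c * u)"
  proof -
    have "(\<Sum>k\<in>{N}. inverse (fact k) * (c * u) ^ k) \<le> (\<Sum>k. inverse (fact k) * (c * u) ^ k)"
      using assms by (intro sum_le_suminf summable_exp) auto
    then show ?thesis
      by (simp add: exp_def field_simps)
  qed
  then show ?thesis
    using assms by (simp add: field_simps power_mult_distrib)
qed

lemma integrable_inverse_one_plus_square: "integrable lborel (\<lambda>x::real. 1 / (1 + x\<^sup>2))"
  using integrable_inverse_1_plus_square by (simp add: set_integrable_def inverse_eq_divide)

text \<open>The two integrations over the line, in the frequency \<open>\<xi>\<close> and in the level \<open>t\<close>, are both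
  compared with the Cauchy density.\<close>

lemma integrable_decay_I:
  fixes g :: "real \<Rightarrow> 'a::{banach, second_countable_topology}"
  assumes "g \<in> borel_measurable borel" "\<And>x. norm (g x) \<le> C * (1 / (1 + x\<^sup>2))"
  shows "integrable lborel g"
proof (rule Bochner_Integration.integrable_bound)
  show "integrable lborel (\<lambda>x. C * (1 / (1 + x\<^sup>2)))"
    by (intro integrable_mult_right integrable_inverse_one_plus_square)
  show "AE x in lborel. norm (g x) \<le> norm (C * (1 / (1 + x\<^sup>2)))"
    unfolding real_norm_def by (intro AE_I2 order_trans[OF assms(2) abs_ge_self])
qed (use assms in simp)

section \<open>The exponent of the tempered stable subordinator\<close>

locale tempered_root_exponent =
  fixes \<mu> :: real and n :: nat
  assumes mu_pos: "\<mu> > 0" and n_ge_2: "n \<ge> 2"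
begin

text \<open>The value of \<open>(s + \<mu>) powr (1/n)\<close> at \<open>s = - \<i>\<xi>\<close>, on the principal branch; \<open>\<rho>\<^sub>0\<close> below is the
  real number \<open>\<rho> 0\<close>.\<close>

definition \<rho> :: "real \<Rightarrow> complex" where
  "\<rho> \<xi> = (complex_of_real \<mu> - \<i> * \<xi>) powr (1 / of_nat n)"

definition \<rho>\<^sub>0 :: real where
  "\<rho>\<^sub>0 = \<mu> powr (1 / real n)"

text \<open>The Laplace exponent of the subordinator on the imaginary axis, at \<open>s = - \<i>\<xi>\<close>.\<close>

definition \<psi> :: "real \<Rightarrow> complex" where
  "\<psi> \<xi> = \<rho> \<xi> - \<rho>\<^sub>0"

lemma rho0_nonneg: "0 \<le> \<rho>\<^sub>0"
  by (simp add: \<rho>\<^sub>0_def)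

lemma rho0_power: "\<rho>\<^sub>0 ^ n = \<mu>"
  using mu_pos n_ge_2 by (simp add: \<rho>\<^sub>0_def powr_realpow[symmetric] powr_powr)

lemma mu_minus_ne_0: "complex_of_real \<mu> - \<i> * complex_of_real \<xi> \<noteq> 0"
  using mu_pos by (auto simp: complex_eq_iff)

lemma rho_power: "\<rho> \<xi> ^ n = complex_of_real \<mu> - \<i> * \<xi>"
  using n_ge_2 mu_minus_ne_0[of \<xi>] by (simp add: \<rho>_def powr_def exp_of_nat_mult[symmetric])

text \<open>The number \<open>\<mu> - \<i>\<xi>\<close> lies in the right half-plane and the root has order at least 2, so the
  argument of \<open>\<rho> \<xi>\<close> is at most \<open>\<pi>/4\<close> in absolute value, with cosine above \<open>1/2\<close>.\<close>

lemma Re_rho_ge: "norm (\<rho> \<xi>) / 2 \<le> Re (\<rho> \<xi>)"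
proof -
  let ?z = "complex_of_real \<mu> - \<i> * \<xi>"
  let ?L = "Ln ?z" and ?\<beta> = "1 / real n"
  have rho_exp: "\<rho> \<xi> = exp (of_real ?\<beta> * ?L)"
    using mu_minus_ne_0 by (simp add: \<rho>_def powr_def)
  have "\<bar>Im ?L\<bar> < pi / 2"
    using mu_pos Re_Ln_pos_lt[of ?z] mu_minus_ne_0 by simp
  then have "\<bar>?\<beta> * Im ?L\<bar> \<le> (1 / 2) * (pi / 2)"
    unfolding abs_mult using n_ge_2 by (intro mult_mono) (auto simp: field_simps)
  also have "\<dots> \<le> pi / 3"
    by simp
  finally have "cos (pi / 3) \<le> cos \<bar>?\<beta> * Im ?L\<bar>"
    using pi_gt_zero by (intro cos_monotone_0_pi_le) auto
  then have "1 / 2 \<le> cos (?\<beta> * Im ?L)"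
    by (simp add: cos_60 cos_abs_real del: abs_divide abs_mult)
  then have "exp (Re (of_real ?\<beta> * ?L)) * (1 / 2) \<le>
      exp (Re (of_real ?\<beta> * ?L)) * cos (Im (of_real ?\<beta> * ?L))"
    by (intro mult_left_mono) auto
  then show ?thesis
    unfolding rho_exp Re_exp norm_exp_eq_Re by simp
qed

lemma measurable_psi [measurable]: "\<psi> \<in> borel_measurable borel"
proof -
  have "continuous_on UNIV \<psi>"
    unfolding \<psi>_def[abs_def] \<rho>_def[abs_def] using mu_pos
    by (intro continuous_intros) (auto simp: complex_nonpos_Reals_iff)
  then show ?thesis
    by (rule borel_measurable_continuous_onI)
qed

text \<open>The \<open>k\<close>-th derivative in \<open>x\<close>, up to the sign \<open>(-1)^k\<close>, of the characteristic function of \<open>D x\<close>.\<close>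

definition damp :: "nat \<Rightarrow> real \<Rightarrow> real \<Rightarrow> complex" where
  "damp k x \<xi> = \<psi> \<xi> ^ k * exp (- of_real x * \<psi> \<xi>)"

lemma measurable_damp [measurable]: "damp k x \<in> borel_measurable borel"
  unfolding damp_def[abs_def] by measurable

text \<open>With \<open>w = \<bar>\<rho> \<xi>\<bar>\<close> the left-hand side is at most a power of \<open>w + \<rho>\<^sub>0\<close> times a decaying
  exponential of \<open>w\<close>, and \<open>w^n = \<bar>\<mu> - \<i>\<xi>\<bar>\<close>. Polynomial decay in \<open>\<xi>\<close> of any order follows; order 2 is
  enough for integrability. The bound is uniform for \<open>x\<close> in a compact interval, as differentiation
  in \<open>x\<close> requires.\<close>

lemma norm_damp_le:
  assumes "0 < lo"
  obtains C where "\<And>x \<xi>. lo \<le> x \<Longrightarrow> x \<le> hi \<Longrightarrow> norm (damp k x \<xi>) \<le> C * (1 / (1 + \<xi>\<^sup>2))"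
proof -
  define c where "c = lo / 2"
  define K where "K = fact k / c ^ k + fact (k + 2 * n) / c ^ (k + 2 * n)"
  have c: "c > 0"
    using assms by (simp add: c_def)
  have "norm (damp k x \<xi>) \<le> (exp ((c + hi) * \<rho>\<^sub>0) * K) * (1 / (1 + \<xi>\<^sup>2))"
    if x: "lo \<le> x" "x \<le> hi" for x \<xi>
  proof -
    define w where "w = norm (\<rho> \<xi>)"
    have w: "w \<ge> 0"
      by (simp add: w_def)
    have "w ^ n = norm (complex_of_real \<mu> - \<i> * \<xi>)"
      by (simp add: w_def norm_power[symmetric] rho_power)
    then have w2: "w ^ (2 * n) = \<mu>\<^sup>2 + \<xi>\<^sup>2"
      by (simp add: power_mult mult.commute[of 2] cmod_power2)
    have psi: "norm (\<psi> \<xi>) \<le> w + \<rho>\<^sub>0"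
      using norm_triangle_ineq4[of "\<rho> \<xi>" "of_real \<rho>\<^sub>0"] rho0_nonneg by (simp add: \<psi>_def w_def)
    have "c * w \<le> x * Re (\<rho> \<xi>)"
      using mult_mono[OF x(1) Re_rho_ge[of \<xi>]] assms x by (simp add: c_def w_def)
    moreover have "x * \<rho>\<^sub>0 \<le> hi * \<rho>\<^sub>0"
      using x rho0_nonneg by (intro mult_right_mono)
    ultimately have "- x * Re (\<psi> \<xi>) \<le> (c + hi) * \<rho>\<^sub>0 - c * (w + \<rho>\<^sub>0)"
      by (simp add: \<psi>_def algebra_simps)
    then have ex: "norm (exp (- of_real x * \<psi> \<xi>)) \<le> exp ((c + hi) * \<rho>\<^sub>0 - c * (w + \<rho>\<^sub>0))"
      by simp
    have "(w + \<rho>\<^sub>0) ^ k * (1 + \<xi>\<^sup>2) \<le> (w + \<rho>\<^sub>0) ^ k * (1 + (w + \<rho>\<^sub>0) ^ (2 * n))"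
    proof (intro mult_left_mono add_left_mono)
      have "\<xi>\<^sup>2 \<le> w ^ (2 * n)"
        unfolding w2 by simp
      also have "\<dots> \<le> (w + \<rho>\<^sub>0) ^ (2 * n)"
        using w rho0_nonneg by (intro power_mono) auto
      finally show "\<xi>\<^sup>2 \<le> (w + \<rho>\<^sub>0) ^ (2 * n)" .
    qed (use w rho0_nonneg in auto)
    also have "\<dots> = (w + \<rho>\<^sub>0) ^ k + (w + \<rho>\<^sub>0) ^ (k + 2 * n)"
      by (simp add: algebra_simps power_add)
    also have "\<dots> \<le> K * exp (c * (w + \<rho>\<^sub>0))"
      unfolding K_def distrib_right using w rho0_nonneg c
      by (intro add_mono power_le_exp) auto
    finally have poly: "(w + \<rho>\<^sub>0) ^ k * (1 + \<xi>\<^sup>2) \<le> K * exp (c * (w + \<rho>\<^sub>0))" .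
    have "norm (damp k x \<xi>) \<le> (w + \<rho>\<^sub>0) ^ k * exp ((c + hi) * \<rho>\<^sub>0 - c * (w + \<rho>\<^sub>0))"
      unfolding damp_def norm_mult norm_power using w rho0_nonneg
      by (intro mult_mono power_mono psi ex) auto
    also have "\<dots> = ((w + \<rho>\<^sub>0) ^ k * (1 + \<xi>\<^sup>2)) * exp ((c + hi) * \<rho>\<^sub>0 - c * (w + \<rho>\<^sub>0)) * (1 / (1 + \<xi>\<^sup>2))"
      using add_pos_nonneg[OF zero_less_one zero_le_power2[of \<xi>]] by simp
    also have "\<dots> \<le> (K * exp (c * (w + \<rho>\<^sub>0))) * exp ((c + hi) * \<rho>\<^sub>0 - c * (w + \<rho>\<^sub>0)) * (1 / (1 + \<xi>\<^sup>2))"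
      by (intro mult_right_mono poly) auto
    also have "\<dots> = (exp ((c + hi) * \<rho>\<^sub>0) * K) * (1 / (1 + \<xi>\<^sup>2))"
      by (simp add: exp_diff)
    finally show ?thesis .
  qed
  then show ?thesis
    using that by blast
qed

section \<open>The Fourier integrals and the equation they satisfy\<close>

text \<open>The integral of \<open>exp (- \<i>\<xi>u)\<close> over \<open>-1 \<le> u \<le> t\<close>, except that division by zero makes it \<open>0\<close> at
  \<open>\<xi> = 0\<close>. Any negative number would do as the lower end: it must leave room below the level \<open>0\<close>,
  where the distribution functions vanish.\<close>

definition \<kappa> :: "real \<Rightarrow> real \<Rightarrow> complex" where
  "\<kappa> t \<xi> = (iexp \<xi> - iexp (- (\<xi> * t))) / (\<i> * \<xi>)"

text \<open>This is \<open>exp (- \<i>\<xi>t)\<close> for \<open>\<xi> \<noteq> 0\<close>. The quotient \<open>\<i>\<xi> / (\<i>\<xi>)\<close> is kept so that \<open>\<kappa>'\<close> is the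
  derivative of \<open>\<kappa>\<close> at \<open>\<xi> = 0\<close> as well, where both are \<open>0\<close>.\<close>

definition \<kappa>' :: "real \<Rightarrow> real \<Rightarrow> complex" where
  "\<kappa>' t \<xi> = \<i> * \<xi> * iexp (- (\<xi> * t)) / (\<i> * \<xi>)"

lemma measurable_kappa [measurable]: "\<kappa> t \<in> borel_measurable borel" "\<kappa>' t \<in> borel_measurable borel"
  unfolding \<kappa>_def[abs_def] \<kappa>'_def[abs_def] by measurable

lemma norm_kappa_le: "-1 \<le> t \<Longrightarrow> norm (\<kappa> t \<xi>) \<le> t + 1"
  using Levy_Inversion_aux2[of "- t" 1 \<xi>] by (cases "\<xi> = 0") (auto simp: \<kappa>_def)

lemma norm_kappa'_le: "norm (\<kappa>' t \<xi>) \<le> 1"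
  using norm_exp_i_times[of "- (\<xi> * t)"]
  by (cases "\<xi> = 0") (auto simp: \<kappa>'_def norm_mult norm_divide simp del: of_real_minus of_real_mult)

lemma kappa_deriv: "((\<lambda>t. \<kappa> t \<xi>) has_vector_derivative \<kappa>' t \<xi>) (at t)"
proof -
  have "((\<lambda>z. iexp \<xi> - exp (\<i> * - (\<xi> * z))) has_field_derivative
      \<i> * \<xi> * exp (\<i> * - (\<xi> * of_real t))) (at (of_real t))"
    by (rule derivative_eq_intros refl | simp)+
  from has_vector_derivative_real_field[OF DERIV_cdivide[OF this, of "\<i> * \<xi>"]] show ?thesis
    by (simp add: \<kappa>_def \<kappa>'_def)
qed

lemma damp_deriv: "((\<lambda>x. damp k x \<xi>) has_vector_derivative - damp (Suc k) x \<xi>) (at x)"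
proof -
  have "((\<lambda>z. \<psi> \<xi> ^ k * exp (- z * \<psi> \<xi>)) has_field_derivative
      - (\<psi> \<xi> ^ Suc k * exp (- of_real x * \<psi> \<xi>))) (at (of_real x))"
    by (rule derivative_eq_intros refl | simp)+
  from has_vector_derivative_real_field[OF this] show ?thesis
    by (simp add: damp_def)
qed

text \<open>\<open>H 0 x t\<close> will be the probability of \<open>D x \<le> t\<close> and \<open>H 1 x t\<close> the density of the first-exit
  time; \<open>J\<close> is the derivative of \<open>H\<close> in \<open>t\<close>.\<close>

definition H :: "nat \<Rightarrow> real \<Rightarrow> real \<Rightarrow> real" where
  "H k x t = (\<integral>\<xi>. Re (\<kappa> t \<xi> * damp k x \<xi>) \<partial>lborel) / (2 * pi)"

definition J :: "nat \<Rightarrow> real \<Rightarrow> real \<Rightarrow> real" where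
  "J k x t = (\<integral>\<xi>. Re (\<kappa>' t \<xi> * damp k x \<xi>) \<partial>lborel) / (2 * pi)"

lemma norm_mult_damp_le:
  assumes "norm z \<le> c" "norm (damp k x \<xi>) \<le> C * (1 / (1 + \<xi>\<^sup>2))"
  shows "norm (z * damp k x \<xi>) \<le> c * C * (1 / (1 + \<xi>\<^sup>2))"
  using mult_mono[OF assms] norm_ge_zero[of z] assms(1) by (simp add: norm_mult mult.assoc)

lemma norm_Re_mult_damp_le:
  assumes "norm z \<le> c" "norm (damp k x \<xi>) \<le> C * (1 / (1 + \<xi>\<^sup>2))"
  shows "norm (Re (z * damp k x \<xi>)) \<le> c * C * (1 / (1 + \<xi>\<^sup>2))"
  using order_trans[OF abs_Re_le_cmod norm_mult_damp_le[OF assms]] by simp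

lemma integrable_kappa_damp:
  assumes "x > 0" "-1 \<le> t"
  shows "integrable lborel (\<lambda>\<xi>. \<kappa> t \<xi> * damp k x \<xi>)"
proof -
  obtain C where C: "\<And>y \<xi>. x \<le> y \<Longrightarrow> y \<le> x \<Longrightarrow> norm (damp k y \<xi>) \<le> C * (1 / (1 + \<xi>\<^sup>2))"
    using norm_damp_le[OF \<open>x > 0\<close>] by metis
  show ?thesis
    by (rule integrable_decay_I[where C = "(t + 1) * C"], measurable)
       (intro norm_mult_damp_le norm_kappa_le C assms order_refl)
qed

lemma integrable_kappa'_damp:
  assumes "x > 0"
  shows "integrable lborel (\<lambda>\<xi>. \<kappa>' t \<xi> * damp k x \<xi>)"
proof -
  obtain C where C: "\<And>y \<xi>. x \<le> y \<Longrightarrow> y \<le> x \<Longrightarrow> norm (damp k y \<xi>) \<le> C * (1 / (1 + \<xi>\<^sup>2))"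
    using norm_damp_le[OF \<open>x > 0\<close>] by metis
  show ?thesis
    by (rule integrable_decay_I[where C = "1 * C"], measurable)
       (intro norm_mult_damp_le norm_kappa'_le C assms order_refl)
qed

lemma H_deriv_x:
  assumes "x > 0" "-1 \<le> t"
  shows "((\<lambda>x. H k x t) has_real_derivative - H (Suc k) x t) (at x)"
proof -
  obtain C where C: "\<And>y \<xi>. x / 2 \<le> y \<Longrightarrow> y \<le> 2 * x \<Longrightarrow>
      norm (damp (Suc k) y \<xi>) \<le> C * (1 / (1 + \<xi>\<^sup>2))"
    using norm_damp_le[OF half_gt_zero[OF \<open>x > 0\<close>]] by metis
  have "((\<lambda>x. \<integral>\<xi>. Re (\<kappa> t \<xi> * damp k x \<xi>) \<partial>lborel) has_real_derivative
      (\<integral>\<xi>. Re (\<kappa> t \<xi> * - damp (Suc k) x \<xi>) \<partial>lborel)) (at x)"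
  proof (rule has_field_derivative_integral[where S = "{x / 2<..<2 * x}"])
    show "integrable lborel (\<lambda>\<xi>. Re (\<kappa> t \<xi> * damp k w \<xi>))" if "w \<in> {x / 2<..<2 * x}" for w
      using that assms by (intro integrable_Re integrable_kappa_damp) auto
    show "((\<lambda>w. Re (\<kappa> t \<xi> * damp k w \<xi>)) has_real_derivative
        Re (\<kappa> t \<xi> * - damp (Suc k) w \<xi>)) (at w)" for w \<xi>
      by (intro has_field_derivative_Re has_vector_derivative_mult_right damp_deriv)
    show "norm (Re (\<kappa> t \<xi> * - damp (Suc k) w \<xi>)) \<le> (t + 1) * C * (1 / (1 + \<xi>\<^sup>2))"
      if "w \<in> {x / 2<..<2 * x}" for w \<xi>
      unfolding mult_minus_right uminus_complex.sel norm_minus_cancel using that assms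
      by (intro norm_Re_mult_damp_le norm_kappa_le C) auto
    show "integrable lborel (\<lambda>\<xi>. (t + 1) * C * (1 / (1 + \<xi>\<^sup>2)))"
      by (intro integrable_mult_right integrable_inverse_one_plus_square)
    show "(\<lambda>\<xi>. Re (\<kappa> t \<xi> * - damp (Suc k) x \<xi>)) \<in> borel_measurable lborel"
      by measurable
  qed (use assms in auto)
  from DERIV_cdivide[OF this, of "2 * pi"] show ?thesis
    by (simp add: H_def del: times_complex.sel)
qed

lemma H_deriv_t:
  assumes "x > 0" "-1 < t"
  shows "(H k x has_real_derivative J k x t) (at t)"
proof -
  obtain C where C: "\<And>y \<xi>. x \<le> y \<Longrightarrow> y \<le> x \<Longrightarrow> norm (damp k y \<xi>) \<le> C * (1 / (1 + \<xi>\<^sup>2))"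
    using norm_damp_le[OF \<open>x > 0\<close>] by metis
  have "((\<lambda>t. \<integral>\<xi>. Re (\<kappa> t \<xi> * damp k x \<xi>) \<partial>lborel) has_real_derivative
      (\<integral>\<xi>. Re (\<kappa>' t \<xi> * damp k x \<xi>) \<partial>lborel)) (at t)"
  proof (rule has_field_derivative_integral[where S = "{-1<..}"])
    show "integrable lborel (\<lambda>\<xi>. Re (\<kappa> w \<xi> * damp k x \<xi>))" if "w \<in> {-1<..}" for w
      using that assms by (intro integrable_Re integrable_kappa_damp) auto
    show "((\<lambda>w. Re (\<kappa> w \<xi> * damp k x \<xi>)) has_real_derivative
        Re (\<kappa>' w \<xi> * damp k x \<xi>)) (at w)" for w \<xi>
      by (intro has_field_derivative_Re has_vector_derivative_mult_left kappa_deriv)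
    show "norm (Re (\<kappa>' w \<xi> * damp k x \<xi>)) \<le> 1 * C * (1 / (1 + \<xi>\<^sup>2))" for w \<xi>
      by (intro norm_Re_mult_damp_le norm_kappa'_le C order_refl)
    show "integrable lborel (\<lambda>\<xi>. 1 * C * (1 / (1 + \<xi>\<^sup>2)))"
      by (intro integrable_mult_right integrable_inverse_one_plus_square)
    show "(\<lambda>\<xi>. Re (\<kappa>' t \<xi> * damp k x \<xi>)) \<in> borel_measurable lborel"
      by measurable
  qed (use assms in auto)
  from DERIV_cdivide[OF this, of "2 * pi"] show ?thesis
    by (simp add: H_def[abs_def] J_def del: times_complex.sel)
qed

lemma H_linear_growth:
  assumes "x > 0"
  obtains C where "\<And>t. -1 \<le> t \<Longrightarrow> \<bar>H k x t\<bar> \<le> C * (1 + t)"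
proof -
  obtain C where C: "\<And>y \<xi>. x \<le> y \<Longrightarrow> y \<le> x \<Longrightarrow> norm (damp k y \<xi>) \<le> C * (1 / (1 + \<xi>\<^sup>2))"
    using norm_damp_le[OF \<open>x > 0\<close>] by metis
  define I where "I = (\<integral>\<xi>. C * (1 / (1 + \<xi>\<^sup>2)) \<partial>lborel)"
  have "\<bar>H k x t\<bar> \<le> I / (2 * pi) * (1 + t)" if "-1 \<le> t" for t
  proof -
    have "norm (\<integral>\<xi>. Re (\<kappa> t \<xi> * damp k x \<xi>) \<partial>lborel) \<le>
        (\<integral>\<xi>. (t + 1) * C * (1 / (1 + \<xi>\<^sup>2)) \<partial>lborel)"
    proof (rule Bochner_Integration.integral_norm_bound_integral)
      show "integrable lborel (\<lambda>\<xi>. Re (\<kappa> t \<xi> * damp k x \<xi>))"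
        using that assms by (intro integrable_Re integrable_kappa_damp)
      show "integrable lborel (\<lambda>\<xi>. (t + 1) * C * (1 / (1 + \<xi>\<^sup>2)))"
        by (intro integrable_mult_right integrable_inverse_one_plus_square)
      show "norm (Re (\<kappa> t \<xi> * damp k x \<xi>)) \<le> (t + 1) * C * (1 / (1 + \<xi>\<^sup>2))" for \<xi>
        using that by (intro norm_Re_mult_damp_le norm_kappa_le C order_refl)
    qed
    also have "\<dots> = I * (1 + t)"
      unfolding I_def mult.assoc integral_mult_right_zero by (simp add: algebra_simps)
    finally have "norm (\<integral>\<xi>. Re (\<kappa> t \<xi> * damp k x \<xi>) \<partial>lborel) / (2 * pi) \<le> I * (1 + t) / (2 * pi)"
      by (intro divide_right_mono) auto
    then show ?thesis
      by (simp add: H_def abs_divide del: times_complex.sel)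
  qed
  then show ?thesis
    using that by blast
qed

lemma mu_powr_eq:
  assumes "j \<le> n"
  shows "\<mu> powr (1 - real j / real n) = \<rho>\<^sub>0 ^ (n - j)"
proof -
  have "\<rho>\<^sub>0 ^ (n - j) = \<mu> powr (1 / real n * real (n - j))"
    using mu_pos by (simp add: \<rho>\<^sub>0_def powr_realpow[symmetric] powr_powr)
  also have "1 / real n * real (n - j) = 1 - real j / real n"
    using assms n_ge_2 by (simp add: of_nat_diff field_simps)
  finally show ?thesis ..
qed

text \<open>This is \<open>(\<psi> \<xi> + \<rho>\<^sub>0)^n - \<rho>\<^sub>0^n = (\<mu> - \<i>\<xi>) - \<mu>\<close>: here the exponent \<open>1/n\<close> turns the Laplace exponent
  into the symbol of a differential operator.\<close>

lemma symbol_binomial: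
  "(\<Sum>j=1..n. of_nat (n choose j) * of_real \<rho>\<^sub>0 ^ (n - j) * \<psi> \<xi> ^ j) = - (\<i> * \<xi>)"
proof -
  have "(\<Sum>j\<le>n. of_nat (n choose j) * \<psi> \<xi> ^ j * of_real \<rho>\<^sub>0 ^ (n - j)) = (\<psi> \<xi> + \<rho>\<^sub>0) ^ n"
    by (rule binomial_ring[symmetric])
  also have "\<dots> = complex_of_real \<mu> - \<i> * \<xi>"
    by (simp add: \<psi>_def rho_power)
  also have "{..n} = insert 0 {1..n}"
    by auto
  finally have "of_real \<rho>\<^sub>0 ^ n + (\<Sum>j=1..n. of_nat (n choose j) * \<psi> \<xi> ^ j * of_real \<rho>\<^sub>0 ^ (n - j)) =
      complex_of_real \<mu> - \<i> * \<xi>"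
    by simp
  then show ?thesis
    using rho0_power[THEN arg_cong[where f = complex_of_real]]
    by (simp add: eq_neg_iff_add_eq_0 algebra_simps)
qed

lemma kappa_times_symbol: "- (\<i> * \<xi>) * \<kappa> t \<xi> = \<kappa>' t \<xi> - \<kappa>' (-1) \<xi>"
  by (cases "\<xi> = 0") (simp_all add: \<kappa>_def \<kappa>'_def field_simps)

text \<open>The sum on the left multiplies the integrand of \<open>H 1 x t\<close> by \<open>- \<i>\<xi>\<close>, which turns \<open>\<kappa>\<close> into a
  difference of two exponentials. The second one is a boundary term that comes from the lower end
  \<open>-1\<close> in \<open>\<kappa>\<close>.\<close>

lemma H_equation:
  assumes "x > 0" "-1 \<le> t"
  shows "(\<Sum>j=1..n. (- 1) ^ j * real (n choose j) * \<mu> powr (1 - real j / real n) *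
      ((- 1) ^ j * H (Suc j) x t)) = J 1 x t - J 1 x (-1)"
proof -
  let ?c = "\<lambda>j. real (n choose j) * \<rho>\<^sub>0 ^ (n - j)"
  have pt: "(\<Sum>j=1..n. ?c j * Re (\<kappa> t \<xi> * damp (Suc j) x \<xi>)) =
      Re (\<kappa>' t \<xi> * damp 1 x \<xi>) - Re (\<kappa>' (-1) \<xi> * damp 1 x \<xi>)" for \<xi>
  proof -
    have "(\<Sum>j=1..n. of_real (?c j) * (\<kappa> t \<xi> * damp (Suc j) x \<xi>)) =
        (\<Sum>j=1..n. of_nat (n choose j) * of_real \<rho>\<^sub>0 ^ (n - j) * \<psi> \<xi> ^ j) * \<kappa> t \<xi> * damp 1 x \<xi>"
      unfolding sum_distrib_right by (intro sum.cong refl) (simp add: damp_def)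
    also have "\<dots> = \<kappa>' t \<xi> * damp 1 x \<xi> - \<kappa>' (-1) \<xi> * damp 1 x \<xi>"
      unfolding symbol_binomial kappa_times_symbol by (simp add: algebra_simps)
    finally have "Re (\<Sum>j=1..n. of_real (?c j) * (\<kappa> t \<xi> * damp (Suc j) x \<xi>)) =
        Re (\<kappa>' t \<xi> * damp 1 x \<xi> - \<kappa>' (-1) \<xi> * damp 1 x \<xi>)"
      by (rule arg_cong)
    moreover have "Re (of_real r * z) = r * Re z" for r z
      by simp
    ultimately show ?thesis
      by (simp only: Re_sum minus_complex.sel)
  qed
  have "(\<Sum>j=1..n. ?c j * H (Suc j) x t) =
      (\<integral>\<xi>. (\<Sum>j=1..n. ?c j * Re (\<kappa> t \<xi> * damp (Suc j) x \<xi>)) \<partial>lborel) / (2 * pi)"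
    by (subst Bochner_Integration.integral_sum)
       (auto simp: H_def sum_divide_distrib simp del: times_complex.sel
          intro!: integrable_mult_right integrable_Re integrable_kappa_damp assms)
  also have "\<dots> = J 1 x t - J 1 x (-1)"
    unfolding pt J_def
    by (subst Bochner_Integration.integral_diff)
       (auto simp: diff_divide_distrib simp del: times_complex.sel
          intro!: integrable_Re integrable_kappa'_damp assms)
  also have "(\<Sum>j=1..n. ?c j * H (Suc j) x t) =
      (\<Sum>j=1..n. (- 1) ^ j * real (n choose j) * \<mu> powr (1 - real j / real n) *
        ((- 1) ^ j * H (Suc j) x t))"
    by (intro sum.cong refl) (auto simp: mu_powr_eq power_mult_distrib[symmetric])
  finally show ?thesis .
qed

end

section \<open>Distribution functions from Laplace transforms\<close>

text \<open>Both sides are holomorphic in the right half-plane and agree on the positive real axis.\<close>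

lemma stable_density_complex_laplace:
  assumes f: "stable_density \<beta> f" and t: "0 < t" and z: "0 < Re z"
  shows "(\<integral>x. exp (- z * of_real x) * of_real (indicator {0<..} x * f x t) \<partial>lborel) =
    exp (- of_real t * z powr of_real \<beta>)"
proof -
  define g where "g x = indicator {0<..} x * f x t" for x :: real
  have [measurable]: "(\<lambda>x. f x t) \<in> borel_measurable borel"
    using f t by (auto simp: stable_density_def)
  have g_meas [measurable]: "g \<in> borel_measurable borel"
    unfolding g_def[abs_def] by measurable
  have g_nonneg: "0 \<le> g x" for x
    using f t by (auto simp: stable_density_def g_def indicator_def)
  have "set_integrable lborel {0<..} (\<lambda>x. exp (- 0 * x) * f x t)"
    using f t unfolding stable_density_def by blast
  then have g_int: "integrable lborel g"
    by (simp add: set_integrable_def g_def[abs_def])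
  define L where "L w = (\<integral>x. exp (- w * of_real x) * complex_of_real (g x) \<partial>lborel)" for w
  have F_le: "norm (exp (- w * of_real x) * complex_of_real (g x)) \<le> norm (g x)"
    if "0 < Re w" for w x
  proof (cases "x > 0")
    case True
    then have "norm (exp (- w * of_real x)) \<le> 1"
      using that by simp
    then show ?thesis
      unfolding norm_mult norm_of_real real_norm_def by (intro mult_left_le_one_le) auto
  qed (simp add: g_def)
  have F_int: "integrable lborel (\<lambda>x. exp (- w * of_real x) * complex_of_real (g x))"
    if "0 < Re w" for w
    using F_le[OF that] by (intro Bochner_Integration.integrable_bound[OF g_int]) auto
  have L_deriv: "(L has_field_derivative
      (\<integral>x. - of_real x * exp (- w * of_real x) * complex_of_real (g x) \<partial>lborel)) (at w)"
    if w: "0 < Re w" for w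
    unfolding L_def[abs_def]
  proof (rule has_field_derivative_integral[where S = "{v. Re w / 2 < Re v}" and B = "\<lambda>x. 2 / Re w * g x"])
    show "open {v. Re w / 2 < Re v}" "convex {v. Re w / 2 < Re v}"
      by (rule open_halfspace_Re_gt convex_halfspace_Re_gt)+
    show "((\<lambda>v. exp (- v * of_real x) * complex_of_real (g x)) has_field_derivative
        - of_real x * exp (- v * of_real x) * complex_of_real (g x)) (at v)" for v x
      by (auto intro!: derivative_eq_intros)
    show "norm (- of_real x * exp (- v * of_real x) * complex_of_real (g x)) \<le> 2 / Re w * g x"
      if "v \<in> {v. Re w / 2 < Re v}" for v x
    proof (cases "x > 0")
      case True
      define a where "a = Re w / 2"
      have a: "0 < a" "a < Re v"
        using w that by (auto simp: a_def)
      \<comment> \<open>from \<open>u * exp (- u) \<le> 1\<close> at \<open>u = a * x\<close>\<close>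
      have "a * x * exp (- Re v * x) \<le> a * x * exp (- (a * x))"
        using a True by (intro mult_left_mono) auto
      also have "\<dots> \<le> exp (a * x) * exp (- (a * x))"
        using exp_ge_add_one_self[of "a * x"] by (intro mult_right_mono exp_ge_zero) linarith
      also have "\<dots> = 1"
        by (simp add: exp_minus)
      finally have "x * exp (- Re v * x) \<le> 1 / a"
        using a by (simp add: field_simps)
      then have "x * exp (- Re v * x) * g x \<le> 1 / a * g x"
        by (intro mult_right_mono g_nonneg)
      then show ?thesis
        using True g_nonneg[of x] by (simp add: norm_mult a_def)
    qed (simp add: g_def)
    show "integrable lborel (\<lambda>x. 2 / Re w * g x)"
      using g_int by simp
  qed (use w F_int in auto)
  have "L z - exp (- of_real t * z powr of_real \<beta>) = 0"
  proof (rule analytic_continuation[where w = z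
        and f = "\<lambda>z. L z - exp (- of_real t * z powr of_real \<beta>)" and S = "{z. 0 < Re z}" and U = "complex_of_real ` {0<..}" and \<xi> = 1])
    show "(\<lambda>z. L z - exp (- of_real t * z powr of_real \<beta>)) holomorphic_on {z. 0 < Re z}"
    proof (rule holomorphic_on_diff)
      show "L holomorphic_on {z. 0 < Re z}"
        using L_deriv by (intro holomorphic_onI) (auto simp: field_differentiable_def
            intro: has_field_derivative_at_within)
      show "(\<lambda>z. exp (- of_real t * z powr of_real \<beta>)) holomorphic_on {z. 0 < Re z}"
        by (intro holomorphic_intros) (auto simp: complex_nonpos_Reals_iff)
    qed
    show "(1 :: complex) islimpt complex_of_real ` {0<..}"
      unfolding islimpt_approachable
    proof (intro allI impI)
      fix e :: real assume "0 < e"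
      then show "\<exists>x'\<in>complex_of_real ` {0<..}. x' \<noteq> 1 \<and> dist x' 1 < e"
        by (intro bexI[of _ "complex_of_real (1 + e / 2)"] imageI) (auto simp: dist_norm)
    qed
    show "L z - exp (- of_real t * z powr of_real \<beta>) = 0" if zU: "z \<in> complex_of_real ` {0<..}" for z
    proof -
      obtain s where s: "z = of_real s" "0 < s"
        using zU by auto
      have "L z = of_real (\<integral>x. exp (- s * x) * g x \<partial>lborel)"
        unfolding L_def s integral_complex_of_real[symmetric]
        by (intro Bochner_Integration.integral_cong refl) (simp add: exp_of_real[symmetric])
      also have "(\<integral>x. exp (- s * x) * g x \<partial>lborel) = (LBINT x:{0<..}. exp (- s * x) * f x t)"
        by (simp add: set_lebesgue_integral_def g_def mult_ac)
      also have "\<dots> = exp (- t * s powr \<beta>)"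
        using f t s unfolding stable_density_def by simp
      finally show ?thesis
        using s by (simp add: exp_of_real[symmetric] powr_of_real)
    qed
    show "connected {z. 0 < Re z}"
      by (intro convex_connected convex_halfspace_Re_gt)
  qed (use z in \<open>auto simp: open_halfspace_Re_gt\<close>)
  then show ?thesis
    by (simp add: L_def g_def)
qed

text \<open>For an integrable integrand, the limit of truncated integrals in Levy's theorem is the
  integral over the whole line.\<close>

lemma (in real_distribution) Levy_Inversion_integrable:
  fixes a b :: real
  assumes "a \<le> b" "measure M {a} = 0" "measure M {b} = 0"
    and int: "integrable lborel
      (\<lambda>t. (iexp (- (t * a)) - iexp (- (t * b))) / (\<i> * t) * char M t)"
      (is "integrable lborel ?F")
  shows "complex_of_real (measure M {a<..b}) = 1 / (2 * pi) *
      (CLBINT t. (iexp (- (t * a)) - iexp (- (t * b))) / (\<i> * t) * char M t)"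
proof -
  have "(\<lambda>T::nat. CLBINT t=ereal (real_of_int (- int T))..ereal (real T). ?F t) = (\<lambda>T. CLBINT t. indicator {-real T<..<real T} t *\<^sub>R ?F t)"
    by (simp add: interval_lebesgue_integral_def set_lebesgue_integral_def)
  also have "\<dots> \<longlonglongrightarrow> (CLBINT t. ?F t)"
  proof (rule integral_dominated_convergence)
    show "integrable lborel (\<lambda>t. norm (?F t))"
      using int by simp
    show "AE t in lborel. (\<lambda>T. indicator {-real T<..<real T} t *\<^sub>R ?F t) \<longlonglongrightarrow> ?F t"
    proof (rule AE_I2, rule tendsto_eventually)
      fix t :: real
      obtain N :: nat where "\<bar>t\<bar> < N"
        using reals_Archimedean2 by blast
      then show "\<forall>\<^sub>F T in sequentially. indicator {-real T<..<real T} t *\<^sub>R ?F t = ?F t"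
        by (intro eventually_sequentiallyI[of N]) (auto simp: indicator_def)
    qed
  qed (use int in \<open>auto simp: indicator_def\<close>)
  finally have "(\<lambda>T::nat. 1 / (2 * pi) * (CLBINT t=ereal (real_of_int (- int T))..ereal (real T). ?F t)) \<longlonglongrightarrow> 1 / (2 * pi) * (CLBINT t. ?F t)"
    by (intro tendsto_mult_left)
  with Levy_Inversion[OF assms(1-3)] show ?thesis
    by (rule LIMSEQ_unique)
qed

context tempered_root_exponent
begin

text \<open>The tempering factor \<open>exp (- \<mu> y)\<close> moves the point \<open>- \<i>\<xi>\<close> on the imaginary axis, where the
  characteristic function is read off, to the point \<open>\<mu> - \<i>\<xi>\<close> inside the half-plane of analyticity.\<close>

lemma char_tempered_stable:
  assumes "prob_space M" and f: "stable_density (1 / real n) f" and x: "0 < x"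
    and X: "distributed M lborel X
      (\<lambda>y. ennreal (tempered_density \<mu> (1 / real n) f y x) * indicator {0<..} y)"
  shows "char (distr M borel X) \<xi> = exp (- of_real x * \<psi> \<xi>)"
proof -
  let ?p = "\<lambda>y. indicator {0<..} y * tempered_density \<mu> (1 / real n) f y x"
  have [measurable]: "(\<lambda>y. f y x) \<in> borel_measurable borel"
    using f x by (auto simp: stable_density_def)
  have p_meas [measurable]: "?p \<in> borel_measurable borel"
    unfolding tempered_density_def by measurable
  have p_nonneg: "0 \<le> ?p y" for y
    using f x by (auto simp: stable_density_def tempered_density_def indicator_def)
  have "distr M borel X = distr M lborel X"
    by (intro distr_cong) auto
  also have "\<dots> = density lborel (\<lambda>y. ennreal (tempered_density \<mu> (1 / real n) f y x) * indicator {0<..} y)"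
    using X by (simp add: distributed_def)
  also have "\<dots> = density lborel (\<lambda>y. ennreal (?p y))"
    by (intro arg_cong[where f = "density lborel"]) (auto simp: indicator_def)
  finally have "char (distr M borel X) \<xi> = (\<integral>y. ?p y *\<^sub>R iexp (\<xi> * y) \<partial>lborel)"
    unfolding char_def using p_nonneg by (simp add: integral_density)
  also have "\<dots> = (\<integral>y. exp (of_real (\<rho>\<^sub>0 * x)) *
      (exp (- (complex_of_real \<mu> - \<i> * \<xi>) * of_real y) * of_real (indicator {0<..} y * f y x)) \<partial>lborel)"
    by (intro Bochner_Integration.integral_cong refl)
       (simp add: tempered_density_def \<rho>\<^sub>0_def scaleR_conv_of_real exp_of_real[symmetric] exp_add[symmetric]
          algebra_simps exp_diff exp_minus)
  also have "\<dots> = exp (of_real (\<rho>\<^sub>0 * x)) * exp (- of_real x * \<rho> \<xi>)"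
    unfolding \<rho>_def integral_mult_right_zero
    by (subst stable_density_complex_laplace[OF f x]) (use mu_pos in auto)
  also have "\<dots> = exp (- of_real x * \<psi> \<xi>)"
    by (simp add: \<psi>_def exp_add[symmetric] algebra_simps)
  finally show ?thesis .
qed

text \<open>Since \<open>D x\<close> is almost surely positive, its law gives no mass to \<open>{..-1}\<close>, and the
  distribution function is the mass of \<open>{-1<..t}\<close>, which the inversion formula computes.\<close>

lemma
  assumes M: "prob_space M" and D: "tempered_stable_subordinator M D \<mu> (1 / real n)"
    and x: "0 < x" and t: "-1 \<le> t"
  shows tempered_stable_cdf: "measure M {\<omega> \<in> space M. D x \<omega> \<le> t} = H 0 x t"
    and tempered_stable_no_atom: "measure M {\<omega> \<in> space M. D x \<omega> = t} = 0"
    and tempered_stable_measurable: "D x \<in> borel_measurable M"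
    and H_0_nonpos_level: "t \<le> 0 \<Longrightarrow> H 0 x t = 0"
proof -
  interpret prob_space M by fact
  obtain f where f: "stable_density (1 / real n) f"
    and X: "distributed M lborel (D x)
      (\<lambda>y. ennreal (tempered_density \<mu> (1 / real n) f y x) * indicator {0<..} y)"
    using D x unfolding tempered_stable_subordinator_def by blast
  show D_meas [measurable]: "D x \<in> borel_measurable M"
    using distributed_measurable[OF X] by simp
  let ?N = "distr M borel (D x)"
  interpret N: real_distribution ?N
    by (rule real_distribution_distr) measurable
  have atom: "measure M {\<omega> \<in> space M. D x \<omega> = s} = 0" for s
  proof -
    have "emeasure M (D x -` {s} \<inter> space M) = 0"
      using distributed_emeasure[OF X, of "{s}"] by simp
    also have "D x -` {s} \<inter> space M = {\<omega> \<in> space M. D x \<omega> = s}"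
      by auto
    finally show ?thesis
      by (simp add: measure_def)
  qed
  show "measure M {\<omega> \<in> space M. D x \<omega> = t} = 0"
    by (rule atom)
  have neg: "measure M {\<omega> \<in> space M. D x \<omega> \<le> s} = 0" if "s \<le> 0" for s
  proof -
    have "emeasure M (D x -` {..s} \<inter> space M) = 0"
      using that unfolding distributed_emeasure[OF X, of "{..s}", simplified]
      by (subst nn_integral_0_iff_AE) (use X in \<open>auto simp: distributed_def indicator_def\<close>)
    also have "D x -` {..s} \<inter> space M = {\<omega> \<in> space M. D x \<omega> \<le> s}"
      by auto
    finally show ?thesis
      by (simp add: measure_def)
  qed
  have N_atom: "measure ?N {s} = 0" for s
    using atom[of s] by (simp add: measure_distr vimage_def Int_def conj_commute)
  have char: "char ?N \<xi> = damp 0 x \<xi>" for \<xi>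
    by (simp add: char_tempered_stable[OF M f x X] damp_def)
  have kappa: "(iexp (- (\<xi> * -1)) - iexp (- (\<xi> * t))) / (\<i> * \<xi>) = \<kappa> t \<xi>" for \<xi>
    by (simp add: \<kappa>_def)
  have "complex_of_real (measure ?N {-1<..t}) = of_real (1 / (2 * pi)) * (CLBINT \<xi>. \<kappa> t \<xi> * damp 0 x \<xi>)"
    using N.Levy_Inversion_integrable[of "-1" t, unfolded kappa char, OF t N_atom N_atom]
      integrable_kappa_damp[OF x t] by simp
  then have "measure ?N {-1<..t} = Re (of_real (1 / (2 * pi)) * (CLBINT \<xi>. \<kappa> t \<xi> * damp 0 x \<xi>))"
    by (metis Re_complex_of_real)
  also have "\<dots> = H 0 x t"
    unfolding H_def scaleR_conv_of_real[symmetric] scaleR_complex.sel using integrable_kappa_damp[OF x t, of 0]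
    by (simp add: integral_Re del: times_complex.sel)
  finally have "measure ?N {-1<..t} = H 0 x t" .
  moreover have "measure ?N {..t} = measure ?N {..-1} + measure ?N {-1<..t}"
    using t by (subst N.finite_measure_Union[symmetric]) (auto intro!: arg_cong[where f = "measure ?N"])
  moreover have "measure ?N {..s} = measure M {\<omega> \<in> space M. D x \<omega> \<le> s}" for s
    by (simp add: measure_distr vimage_def Int_def conj_commute)
  ultimately show H: "measure M {\<omega> \<in> space M. D x \<omega> \<le> t} = H 0 x t"
    using neg[of "-1"] by simp
  show "H 0 x t = 0" if "t \<le> 0"
    using neg[OF that] H by simp
qed

end

section \<open>The first-exit time\<close>

text \<open>If \<open>D x < t\<close>, right-continuity keeps the path below \<open>t\<close> for some time after \<open>x\<close>; only the null
  event \<open>D x = t\<close> would be ambiguous. The last assumption excludes paths that never exceed \<open>t\<close>,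
  for which the infimum is taken over the empty set.\<close>

lemma first_exit_greater_iff:
  assumes sub: "subordinator M D" and x: "0 < x"
    and no_atom: "AE \<omega> in M. D x \<omega> \<noteq> t"
    and exits: "AE \<omega> in M. first_exit D t \<omega> \<noteq> Inf {}"
  shows "AE \<omega> in M. x < first_exit D t \<omega> \<longleftrightarrow> D x \<omega> \<le> t"
  using no_atom exits subordinator.nondecreasing_paths[OF sub] subordinator.right_continuous_paths[OF sub]
proof eventually_elim
  case (elim \<omega>)
  define S where "S = {y. 0 < y \<and> t < D y \<omega>}"
  have exit_eq: "first_exit D t \<omega> = Inf S"
    by (simp add: first_exit_def S_def conj_commute)
  have S_ne: "S \<noteq> {}"
    using elim(2) exit_eq by auto
  have S_bdd: "bdd_below S"
    by (rule bdd_belowI[of _ 0]) (auto simp: S_def)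
  show ?case
  proof
    assume "x < first_exit D t \<omega>"
    then have "x \<notin> S"
      unfolding exit_eq using cInf_lower[OF _ S_bdd, of x] by auto
    then show "D x \<omega> \<le> t"
      using x by (simp add: S_def)
  next
    assume "D x \<omega> \<le> t"
    then have "D x \<omega> < t"
      using elim(1) by simp
    moreover have "((\<lambda>u. D u \<omega>) \<longlongrightarrow> D x \<omega>) (at_right x)"
      using elim(4) x by (simp add: continuous_within)
    ultimately have "\<forall>\<^sub>F u in at_right x. D u \<omega> < t"
      by (intro order_tendstoD(2))
    then obtain c where c: "x < c" "\<And>u. x < u \<Longrightarrow> u < c \<Longrightarrow> D u \<omega> < t"
      unfolding eventually_at_right_field by blast
    define d where "d = (x + c) / 2"
    have d: "x < d" "D d \<omega> < t"
      using c by (auto simp: d_def)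
    have "d \<le> y" if "y \<in> S" for y
    proof (rule ccontr)
      assume "\<not> d \<le> y"
      then have "D y \<omega> \<le> D d \<omega>"
        using elim(3) that x by (auto simp: mono_on_def S_def)
      then show False
        using that d by (simp add: S_def)
    qed
    then have "d \<le> Inf S"
      using S_ne by (intro cInf_greatest)
    then show "x < first_exit D t \<omega>"
      using d by (simp add: exit_eq)
  qed
qed

text \<open>The tail probability differs from a constant by an integral of the continuous density, so
  that the fundamental theorem of calculus identifies the density at every single point.\<close>

lemma (in prob_space) density_eq_minus_tail_derivative:
  fixes p G :: "real \<Rightarrow> real"
  assumes X: "distributed M lborel X (\<lambda>y. ennreal (p y) * indicator {0<..} y)"
    and p_nonneg: "\<And>y. 0 < y \<Longrightarrow> 0 \<le> p y" and p_cont: "continuous_on {0<..} p"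
    and tail: "\<And>y. 0 < y \<Longrightarrow> prob {\<omega> \<in> space M. y < X \<omega>} = G y"
    and deriv: "(G has_real_derivative G') (at x)" and x: "0 < x"
  shows "p x = - G'"
proof -
  have [measurable]: "random_variable borel X"
    using distributed_measurable[OF X] by simp
  define a where "a = x / 2"
  have a: "0 < a" "a < x"
    using x by (auto simp: a_def)
  have G_eq: "G y = G a - integral {a..y} p" if "a \<le> y" for y
  proof -
    have cont: "continuous_on {a..y} p"
      using a by (intro continuous_on_subset[OF p_cont]) auto
    have int: "set_integrable lborel {a..y} p"
      by (rule borel_integrable_atLeastAtMost'[OF cont])
    have nonneg: "0 \<le> integral {a..y} p"
      using p_nonneg a by (intro Henstock_Kurzweil_Integration.integral_nonneg
          integrable_continuous_real[OF cont]) auto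
    have "emeasure M (X -` {a<..y} \<inter> space M) =
        (\<integral>\<^sup>+z. ennreal (p z) * indicator {0<..} z * indicator {a<..y} z \<partial>lborel)"
      by (intro distributed_emeasure[OF X]) auto
    also have "\<dots> = (\<integral>\<^sup>+z. ennreal (indicator {a..y} z *\<^sub>R p z) \<partial>lborel)"
    proof (rule nn_integral_cong_AE)
      show "AE z in lborel. ennreal (p z) * indicator {0<..} z * indicator {a<..y} z =
          ennreal (indicator {a..y} z *\<^sub>R p z)"
        using AE_lborel_singleton[of a] by eventually_elim (use a in \<open>auto simp: indicator_def\<close>)
    qed
    also have "\<dots> = ennreal (integral {a..y} p)"
      using int p_nonneg a
      by (subst nn_integral_eq_integral)
         (auto simp: set_integrable_def indicator_def set_borel_integral_eq_integral(2)[OF int, symmetric]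
            set_lebesgue_integral_def)
    finally have "prob (X -` {a<..y} \<inter> space M) = integral {a..y} p"
      using nonneg by (simp add: measure_def)
    moreover have "prob {\<omega> \<in> space M. a < X \<omega>} =
        prob (X -` {a<..y} \<inter> space M) + prob {\<omega> \<in> space M. y < X \<omega>}"
      using that by (subst finite_measure_Union[symmetric]) (auto intro!: arg_cong[where f = prob])
    ultimately show ?thesis
      using tail[of a] tail[of y] a that by simp
  qed
  have "continuous_on {a..2 * x} p"
    using a by (intro continuous_on_subset[OF p_cont]) auto
  then have "((\<lambda>u. integral {a..u} p) has_vector_derivative p x) (at x within {a..2 * x})"
    using a x by (intro integral_has_vector_derivative) auto
  then have "((\<lambda>u. integral {a..u} p) has_real_derivative p x) (at x)"
    using a x by (simp add: has_real_derivative_iff_has_vector_derivative at_within_Icc_at)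
  then have "((\<lambda>u. G a - integral {a..u} p) has_real_derivative - p x) (at x)"
    by (auto intro!: derivative_eq_intros)
  then have "(G has_real_derivative - p x) (at x)"
    by (rule has_field_derivative_transform_within_open[where S = "{a<..}"]) (use a G_eq[symmetric] in auto)
  then show ?thesis
    using DERIV_unique[OF deriv] by simp
qed

section \<open>Laplace transforms of functions of linear growth\<close>

lemma exp_linear_growth_le:
  fixes h :: "real \<Rightarrow> real"
  assumes growth: "\<And>t. 0 \<le> t \<Longrightarrow> \<bar>h t\<bar> \<le> C * (1 + t)" and "0 < s" "0 \<le> t"
  shows "norm (exp (- s * t) * h t) \<le> C * (fact 3 / s ^ 3 * exp s) * (1 / (1 + t\<^sup>2))"
proof -
  have C: "0 \<le> C"
    using growth[of 0] by simp
  have "(1 + t) * (1 + t\<^sup>2) \<le> (1 + t) ^ 3"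
    using \<open>0 \<le> t\<close> by (simp add: power3_eq_cube power2_eq_square algebra_simps)
  also have "\<dots> \<le> fact 3 / s ^ 3 * exp (s * (1 + t))"
    using assms by (intro power_le_exp) auto
  finally have "C * ((1 + t) * (1 + t\<^sup>2)) \<le> C * (fact 3 / s ^ 3 * exp (s * (1 + t)))"
    using C by (intro mult_left_mono)
  moreover have "\<bar>h t\<bar> * (1 + t\<^sup>2) \<le> C * (1 + t) * (1 + t\<^sup>2)"
    using growth[OF \<open>0 \<le> t\<close>] by (intro mult_right_mono) auto
  ultimately have "\<bar>h t\<bar> * (1 + t\<^sup>2) \<le> C * (fact 3 / s ^ 3 * exp (s * (1 + t)))"
    by (simp only: mult.assoc order_trans)
  then have "exp (- s * t) * (\<bar>h t\<bar> * (1 + t\<^sup>2)) \<le> exp (- s * t) * (C * (fact 3 / s ^ 3 * exp (s * (1 + t))))"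
    by (intro mult_left_mono) auto
  also have "\<dots> = C * (fact 3 / s ^ 3 * (exp (- s * t) * exp (s * (1 + t))))"
    by (simp only: mult_ac times_divide_eq_left times_divide_eq_right)
  also have "exp (- s * t) * exp (s * (1 + t)) = exp s"
    unfolding exp_add[symmetric] by (simp add: algebra_simps)
  finally have "exp (- s * t) * \<bar>h t\<bar> * (1 + t\<^sup>2) \<le> C * (fact 3 / s ^ 3 * exp s)"
    by (simp only: mult.assoc)
  moreover have "0 < 1 + t\<^sup>2"
    by (intro add_pos_nonneg) auto
  ultimately have "exp (- s * t) * \<bar>h t\<bar> \<le> C * (fact 3 / s ^ 3 * exp s) / (1 + t\<^sup>2)"
    by (simp only: pos_le_divide_eq)
  then show ?thesis
    by (simp add: abs_mult)
qed

lemma linear_growth_laplace_integrable: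
  fixes h :: "real \<Rightarrow> real"
  assumes cont: "continuous_on {0..} h" and growth: "\<And>t. 0 \<le> t \<Longrightarrow> \<bar>h t\<bar> \<le> C * (1 + t)"
    and "0 < s"
  shows "set_integrable lborel {0<..} (\<lambda>t. exp (- s * t) * h t)"
  unfolding set_integrable_def
proof (rule integrable_decay_I[where C = "C * (fact 3 / s ^ 3 * exp s)"])
  show "(\<lambda>t. indicator {0<..} t *\<^sub>R (exp (- s * t) * h t)) \<in> borel_measurable borel"
    by (intro borel_measurable_continuous_on_indicator continuous_intros continuous_on_subset[OF cont]) auto
  have C: "0 \<le> C * (fact 3 / s ^ 3 * exp s)"
    using growth[of 0] \<open>0 < s\<close> by simp
  show "norm (indicator {0<..} t *\<^sub>R (exp (- s * t) * h t)) \<le>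
      C * (fact 3 / s ^ 3 * exp s) * (1 / (1 + t\<^sup>2))" for t
    using exp_linear_growth_le[of h, OF growth \<open>0 < s\<close>, of t] mult_nonneg_nonneg[OF C, of "1 / (1 + t\<^sup>2)"]
    by (cases "0 < t") (auto simp del: times_divide_eq_right)
qed

text \<open>The derivatives \<open>partial_t m x\<close> and \<open>partial_x j m x\<close> are under control for positive \<open>t\<close> only;
  their values at \<open>0\<close> form a null set, which has to be split off explicitly as the domain of
  integration is \<open>{0..}\<close>.\<close>

lemma laplace_eq_open_half_line:
  assumes int: "set_integrable lborel {0<..} (\<lambda>t. exp (- s * t) * h t)"
    and eq: "\<And>t. 0 < t \<Longrightarrow> g t = h t"
  shows "laplace_integrable lborel g s"
    and "laplace lborel g s = (LBINT t:{0<..}. exp (- s * t) * h t)"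
proof -
  have eq_sum: "(\<lambda>t. indicator {0..} t *\<^sub>R (exp (- s * t) * g t)) =
      (\<lambda>t. indicator {0<..} t *\<^sub>R (exp (- s * t) * h t) + indicator {0} t *\<^sub>R g 0)"
    by (auto simp: fun_eq_iff indicator_def eq)
  have "integrable lborel (\<lambda>t. indicator {0::real} t *\<^sub>R g 0)"
    by (intro integrable_scaleR_left) simp
  note int = int[unfolded set_integrable_def] this
  show "laplace_integrable lborel g s"
    unfolding laplace_integrable_def set_integrable_def eq_sum
    by (intro Bochner_Integration.integrable_add int)
  show "laplace lborel g s = (LBINT t:{0<..}. exp (- s * t) * h t)"
    unfolding laplace_def set_lebesgue_integral_def eq_sum Bochner_Integration.integral_add[OF int]
    by simp
qed

text \<open>Integration by parts: \<open>exp (- s * t) * h t\<close> is an antiderivative that tends to \<open>h 0\<close> and \<open>0\<close> at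
  the ends of the half-line.\<close>

lemma laplace_integral_of_derivative:
  fixes h h' :: "real \<Rightarrow> real"
  assumes cont: "continuous_on {0..} h" "continuous_on {0..} h'"
    and growth: "\<And>t. 0 \<le> t \<Longrightarrow> \<bar>h t\<bar> \<le> C * (1 + t)" "\<And>t. 0 \<le> t \<Longrightarrow> \<bar>h' t\<bar> \<le> C' * (1 + t)"
    and deriv: "\<And>t. 0 < t \<Longrightarrow> (h has_real_derivative h' t) (at t)"
    and s: "0 < s"
  shows "(LBINT t:{0<..}. exp (- s * t) * h' t) = s * (LBINT t:{0<..}. exp (- s * t) * h t) - h 0"
proof -
  let ?F = "\<lambda>t. exp (- s * t) * h t"
  let ?f = "\<lambda>t. exp (- s * t) * h' t - s * (exp (- s * t) * h t)"
  have int: "set_integrable lborel {0<..} ?F" "set_integrable lborel {0<..} (\<lambda>t. exp (- s * t) * h' t)"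
    using cont growth s by (blast intro: linear_growth_laplace_integrable)+
  have half_line: "einterval 0 \<infinity> = {0<..}"
    by (auto simp: einterval_def)
  have isCont: "isCont h t" "isCont h' t" if "0 < t" for t
    using that cont by (auto intro!: continuous_on_interior[where S = "{0..}"])
  have "(LBINT t=0..\<infinity>. ?f t) = 0 - h 0"
  proof (rule interval_integral_FTC_integrable)
    show "(?F has_vector_derivative ?f t) (at t)" if "0 < ereal t" for t
      unfolding has_real_derivative_iff_has_vector_derivative[symmetric]
      using that by (auto intro!: derivative_eq_intros deriv)
    show "isCont ?f t" if "0 < ereal t" for t
      using that isCont by (intro continuous_intros) auto
    show "set_integrable lborel (einterval 0 \<infinity>) ?f"
      unfolding half_line by (intro set_integral_diff(1) set_integrable_mult_right int)
    have "((\<lambda>t. ?F t) \<longlongrightarrow> exp (- s * 0) * h 0) (at 0 within {0..})"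
      using cont(1) by (intro tendsto_intros) (auto simp: continuous_on_def)
    then have "(?F \<longlongrightarrow> h 0) (at_right 0)"
      by (auto intro: tendsto_within_subset)
    then show "((?F \<circ> real_of_ereal) \<longlongrightarrow> h 0) (at_right 0)"
      by (simp add: zero_ereal_def ereal_tendsto_simps)
    have "filterlim (\<lambda>t::real. 1 + t\<^sup>2) at_top at_top"
    proof (rule filterlim_at_top_mono[OF filterlim_ident])
      show "\<forall>\<^sub>F t::real in at_top. t \<le> 1 + t\<^sup>2"
      proof (rule always_eventually, rule allI)
        fix t :: real
        have "0 \<le> (t - 1 / 2)\<^sup>2" by simp
        then show "t \<le> 1 + t\<^sup>2" by (simp add: power2_eq_square algebra_simps)
      qed
    qed
    then have "((\<lambda>t::real. C * (fact 3 / s ^ 3 * exp s) * inverse (1 + t\<^sup>2)) \<longlongrightarrow> 0) at_top"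
      by (intro tendsto_mult_right_zero tendsto_inverse_0_at_top)
    moreover have "\<forall>\<^sub>F t in at_top. norm (?F t) \<le> C * (fact 3 / s ^ 3 * exp s) * inverse (1 + t\<^sup>2)"
      using eventually_ge_at_top[of 0]
      by eventually_elim (use exp_linear_growth_le[of h, OF growth(1) s] in \<open>simp add: inverse_eq_divide\<close>)
    ultimately have "(?F \<longlongrightarrow> 0) at_top"
      by (rule Lim_null_comparison[rotated])
    then show "((?F \<circ> real_of_ereal) \<longlongrightarrow> 0) (at_left \<infinity>)"
      by (simp add: ereal_tendsto_simps)
  qed auto
  moreover have "(LBINT t=0..\<infinity>. ?f t) = (LBINT t:{0<..}. ?f t)"
    by (simp add: interval_lebesgue_integral_def half_line)
  moreover have "\<dots> = (LBINT t:{0<..}. exp (- s * t) * h' t) - s * (LBINT t:{0<..}. ?F t)"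
    using set_integral_diff(2)[OF int(2) set_integrable_mult_right[OF int(1), of s]] by simp
  ultimately show ?thesis
    by simp
qed

section \<open>The first-exit density\<close>

context tempered_root_exponent
begin

lemma H_eq_0:
  assumes H0: "\<And>x t. 0 < x \<Longrightarrow> -1 \<le> t \<Longrightarrow> t \<le> 0 \<Longrightarrow> H 0 x t = 0"
    and "0 < x" "-1 \<le> t" "t \<le> 0"
  shows "H k x t = 0"
  using \<open>0 < x\<close>
proof (induction k arbitrary: x)
  case 0
  then show ?case
    using assms by simp
next
  case (Suc k)
  have "((\<lambda>x. H k x t) has_real_derivative 0) (at x)"
    by (rule has_field_derivative_transform_within_open[where f = "\<lambda>_. 0" and S = "{0<..}"])
       (use Suc in auto)
  from DERIV_unique[OF this H_deriv_x[OF Suc.prems \<open>-1 \<le> t\<close>]] show ?case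
    by simp
qed

text \<open>All \<open>H k x t\<close> and \<open>J 1 x t\<close> vanish for \<open>-1 < t < 0\<close>. At such a level, for instance \<open>-1/2\<close>, the
  boundary term is the only one left in \<open>H_equation\<close>.\<close>

lemma J_boundary_eq_0:
  assumes H0: "\<And>x t. 0 < x \<Longrightarrow> -1 \<le> t \<Longrightarrow> t \<le> 0 \<Longrightarrow> H 0 x t = 0" and x: "0 < x"
  shows "J 1 x (-1) = 0"
proof -
  have H: "H k x t = 0" if "-1 \<le> t" "t \<le> 0" for k t
    using H_eq_0[OF H0] x that by blast
  have "(H 1 x has_real_derivative 0) (at (-1/2))"
    by (rule has_field_derivative_transform_within_open[where f = "\<lambda>_. 0" and S = "{-1<..<0}"])
       (use H in auto)
  then have "J 1 x (-1/2) = 0"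
    using DERIV_unique[OF _ H_deriv_t[OF x, of "-1/2" 1]] by simp
  then show ?thesis
    using H_equation[OF x, of "-1/2"] H by simp
qed

lemma H_continuous: "0 < x \<Longrightarrow> continuous_on {0..} (H k x)"
  by (intro continuous_at_imp_continuous_on ballI DERIV_isCont[OF H_deriv_t]) auto

text \<open>The tail of the first-exit time is \<open>P(D x \<le> t) = H 0 x t\<close>, whose derivative in \<open>x\<close> is
  \<open>- H 1 x t\<close>.\<close>

lemma first_exit_density_eq_H:
  assumes D: "tempered_stable_subordinator M D \<mu> (1 / real n)"
    and m: "first_exit_density M D m" and x: "0 < x" and t: "0 < t"
  shows "m x t = H 1 x t"
proof -
  have sub: "subordinator M D"
    using D by (simp add: tempered_stable_subordinator_def)
  interpret subordinator M D by (rule sub)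
  have E: "distributed M lborel (first_exit D t) (\<lambda>x. ennreal (m x t) * indicator {0<..} x)"
    and m_nonneg: "\<And>y. 0 < y \<Longrightarrow> 0 \<le> m y t" and m_cont: "continuous_on {0<..} (\<lambda>y. m y t)"
    using m t by (auto simp: first_exit_density_def)
  have [measurable]: "first_exit D t \<in> borel_measurable M"
    using distributed_measurable[OF E] by simp
  \<comment> \<open>On paths that never exceed \<open>t\<close> the first-exit time is the fixed number \<open>Inf {}\<close>. As it has a
    density, it takes this value with probability zero, so almost all paths exceed \<open>t\<close>.\<close>
  have "emeasure M (first_exit D t -` {Inf {}} \<inter> space M) = 0"
    using distributed_emeasure[OF E, of "{Inf {}}"] by simp
  then have exits: "AE \<omega> in M. first_exit D t \<omega> \<noteq> Inf {}"
    by (intro AE_I[where N = "first_exit D t -` {Inf {}} \<inter> space M"]) auto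
  have tail: "prob {\<omega> \<in> space M. y < first_exit D t \<omega>} = H 0 y t" if y: "0 < y" for y
  proof -
    have [measurable]: "D y \<in> borel_measurable M"
      using tempered_stable_measurable[OF prob_space_axioms D y, of t] t by simp
    have "AE \<omega> in M. D y \<omega> \<noteq> t"
      using tempered_stable_no_atom[OF prob_space_axioms D y, of t] t
      by (subst AE_iff_measurable[OF _ refl]) (auto simp: emeasure_eq_measure)
    from first_exit_greater_iff[OF sub y this exits]
    have "prob {\<omega> \<in> space M. y < first_exit D t \<omega>} = prob {\<omega> \<in> space M. D y \<omega> \<le> t}"
      by (intro finite_measure_eq_AE) auto
    then show ?thesis
      using tempered_stable_cdf[OF prob_space_axioms D y, of t] t by simp
  qed
  have "((\<lambda>y. H 0 y t) has_real_derivative - H (Suc 0) x t) (at x)"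
    using x t by (intro H_deriv_x) auto
  from density_eq_minus_tail_derivative[OF E m_nonneg m_cont tail this x] show ?thesis
    by simp
qed

lemma signed_H_deriv_x:
  assumes g: "\<And>y. 0 < y \<Longrightarrow> g y = (-1) ^ j * H (Suc j) y t" and t: "0 < t" and x: "0 < x"
  shows "(g has_real_derivative (-1) ^ Suc j * H (Suc (Suc j)) x t) (at x)"
proof (rule has_field_derivative_transform_within_open[where S = "{0<..}"])
  show "((\<lambda>y. (-1) ^ j * H (Suc j) y t) has_real_derivative (-1) ^ Suc j * H (Suc (Suc j)) x t) (at x)"
    using DERIV_cmult[OF H_deriv_x[of x t "Suc j"], of "(-1) ^ j"] t x by simp
qed (use g x in auto)

lemma iterated_deriv_H:
  assumes f: "\<And>y. 0 < y \<Longrightarrow> f y = H 1 y t" and t: "0 < t" and x: "0 < x"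
  shows "(deriv ^^ j) f x = (-1) ^ j * H (Suc j) x t"
  using x
proof (induction j arbitrary: x)
  case 0
  then show ?case
    by (simp add: f)
next
  case (Suc j)
  show ?case
    using DERIV_imp_deriv[OF signed_H_deriv_x[OF Suc.IH t Suc.prems]] by simp
qed

end

theorem proposition3p1:
  fixes M :: "'a measure" and D :: "real \<Rightarrow> 'a \<Rightarrow> real" and m :: "real \<Rightarrow> real \<Rightarrow> real"
    and \<mu> \<beta> :: real and n :: nat
  assumes "\<mu> > 0" and "n \<ge> 2" and "\<beta> = 1 / real n"
    and "tempered_stable_subordinator M D \<mu> \<beta>"
    and "first_exit_density M D m"
  shows "\<forall>x>0.
      (\<forall>t>0. (\<forall>j<n. (\<lambda>y. partial_x j m y t) differentiable at x) \<and> m x differentiable at t \<and>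
         (\<Sum>j=1..n. (- 1) ^ j * real (n choose j) * \<mu> powr (1 - real j / real n)
             * partial_x j m x t)
         = partial_t m x t) \<and>
      (m x \<longlongrightarrow> m x 0) (at_right 0) \<and>
      (\<forall>s>0.
         laplace_integrable lborel (m x) s \<and>
         laplace_integrable lborel (partial_t m x) s \<and>
         (\<forall>j\<in>{1..n}. laplace_integrable lborel (partial_x j m x) s) \<and>
         laplace lborel (partial_t m x) s = s * laplace lborel (m x) s - m x 0 \<and>
         (\<Sum>j=1..n. (- 1) ^ j * real (n choose j) * \<mu> powr (1 - real j / real n)
             * laplace lborel (partial_x j m x) s)
         = laplace lborel (partial_t m x) s + laplace dirac_delta (\<lambda>t. m x 0) s)"
proof (intro allI impI)
  fix x :: real assume x: "0 < x"
  interpret tempered_root_exponent \<mu> n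
    using assms by unfold_locales
  have D: "tempered_stable_subordinator M D \<mu> (1 / real n)"
    using assms by simp
  then interpret subordinator M D
    by (simp add: tempered_stable_subordinator_def)
  have H0: "H 0 y t = 0" if "0 < y" "-1 \<le> t" "t \<le> 0" for y t
    using H_0_nonpos_level[OF prob_space_axioms D] that by blast
  have m_eq: "m y t = H 1 y t" if "0 < y" "0 < t" for y t
    using first_exit_density_eq_H[OF D assms(5) that] .
  define c where "c j = (- 1) ^ j * real (n choose j) * \<mu> powr (1 - real j / real n)" for j
  have px: "partial_x j m y t = (-1) ^ j * H (Suc j) y t" if "0 < t" and y: "0 < y" for j y t
    unfolding partial_x_def by (rule iterated_deriv_H) (use that y m_eq in auto)
  have m_deriv: "(m x has_real_derivative J 1 x t) (at t)" if "0 < t" for t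
    by (rule has_field_derivative_transform_within_open[where f = "H 1 x" and S = "{0<..}"])
       (use that x m_eq H_deriv_t in auto)
  have pt: "partial_t m x t = J 1 x t" if "0 < t" for t
    unfolding partial_t_def by (rule DERIV_imp_deriv[OF m_deriv[OF that]])
  have J_eq: "(\<Sum>j=1..n. c j * ((-1) ^ j * H (Suc j) x t)) = J 1 x t" if "0 \<le> t" for t
    using H_equation[OF x, of t] J_boundary_eq_0[OF H0 x] that by (simp add: c_def)

  have equation: "(\<Sum>j=1..n. c j * partial_x j m x t) = partial_t m x t" if "0 < t" for t
    using J_eq[of t] that x by (simp add: px pt)
  have diff_x: "(\<lambda>y. partial_x j m y t) differentiable at x" if "0 < t" for j t
    using signed_H_deriv_x[OF px[OF that] that x] by (auto simp: real_differentiable_def)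
  have diff_t: "m x differentiable at t" if "0 < t" for t
    using m_deriv[OF that] by (auto simp: real_differentiable_def)

  have H_zero: "H k x 0 = 0" for k
    using H_eq_0[OF H0 x] by simp
  have "(H 1 x \<longlongrightarrow> H 1 x 0) (at 0)"
    using DERIV_isCont[OF H_deriv_t[OF x, of 0]] by (simp add: isCont_def)
  then have "(H 1 x \<longlongrightarrow> 0) (at_right 0)"
    unfolding H_zero by (rule tendsto_within_subset) auto
  then have lim0: "(m x \<longlongrightarrow> 0) (at_right 0)"
    by (rule Lim_transform_eventually)
       (auto simp: eventually_at_right_field m_eq x intro!: exI[of _ 1])
  have "m x 0 = Lim (at_right 0) (m x)"
    using assms(5) x by (auto simp: first_exit_density_def)
  then have m0: "m x 0 = 0"
    using tendsto_Lim[OF _ lim0] by simp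

  have "\<forall>k. \<exists>C. \<forall>t\<ge>0. \<bar>H k x t\<bar> \<le> C * (1 + t)"
  proof
    fix k
    obtain C where "\<And>t. -1 \<le> t \<Longrightarrow> \<bar>H k x t\<bar> \<le> C * (1 + t)"
      using H_linear_growth[OF x] by metis
    then show "\<exists>C. \<forall>t\<ge>0. \<bar>H k x t\<bar> \<le> C * (1 + t)"
      by (intro exI[of _ C]) auto
  qed
  then obtain C where C: "\<And>k t. 0 \<le> t \<Longrightarrow> \<bar>H k x t\<bar> \<le> C k * (1 + t)"
    by metis
  have signed_growth: "\<bar>(-1) ^ j * H (Suc j) x t\<bar> \<le> C (Suc j) * (1 + t)" if "0 \<le> t" for j t
    using C[OF that] by (simp add: abs_mult)
  \<comment> \<open>\<open>J 1 x\<close> inherits growth and continuity from the sum of the \<open>H k x\<close> to which it is equal.\<close>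
  have J_growth: "\<bar>J 1 x t\<bar> \<le> (\<Sum>j=1..n. \<bar>c j\<bar> * C (Suc j)) * (1 + t)" if "0 \<le> t" for t
  proof -
    have "\<bar>J 1 x t\<bar> \<le> (\<Sum>j=1..n. \<bar>c j * ((-1) ^ j * H (Suc j) x t)\<bar>)"
      unfolding J_eq[OF that, symmetric] by (rule sum_abs)
    also have "\<dots> \<le> (\<Sum>j=1..n. \<bar>c j\<bar> * (C (Suc j) * (1 + t)))"
      unfolding abs_mult[of "c _"] by (intro sum_mono mult_left_mono signed_growth that) auto
    finally show ?thesis
      by (simp add: sum_distrib_right mult.assoc)
  qed
  have "continuous_on {0..} (\<lambda>t. \<Sum>j=1..n. c j * ((-1) ^ j * H (Suc j) x t))"
    by (intro continuous_intros H_continuous x)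
  then have J_cont: "continuous_on {0..} (J 1 x)"
    by (rule continuous_on_eq) (rule J_eq, simp)

  have laplace_facts: "laplace_integrable lborel (m x) s \<and>
         laplace_integrable lborel (partial_t m x) s \<and>
         (\<forall>j\<in>{1..n}. laplace_integrable lborel (partial_x j m x) s) \<and>
         laplace lborel (partial_t m x) s = s * laplace lborel (m x) s - m x 0 \<and>
         (\<Sum>j=1..n. c j * laplace lborel (partial_x j m x) s)
         = laplace lborel (partial_t m x) s + laplace dirac_delta (\<lambda>t. m x 0) s"
    if s: "0 < s" for s
  proof -
    have int_H: "set_integrable lborel {0<..} (\<lambda>t. exp (- s * t) * H 1 x t)"
      using H_continuous[OF x] C s by (rule linear_growth_laplace_integrable)
    have int_J: "set_integrable lborel {0<..} (\<lambda>t. exp (- s * t) * J 1 x t)"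
      using J_cont J_growth s by (rule linear_growth_laplace_integrable)
    have int_x: "set_integrable lborel {0<..} (\<lambda>t. exp (- s * t) * ((-1) ^ j * H (Suc j) x t))" for j
      using continuous_on_mult_left[OF H_continuous[OF x]] signed_growth s
      by (rule linear_growth_laplace_integrable)
    have L_m: "laplace_integrable lborel (m x) s"
        "laplace lborel (m x) s = (LBINT t:{0<..}. exp (- s * t) * H 1 x t)"
      using laplace_eq_open_half_line[OF int_H] m_eq[OF x] by blast+
    have L_t: "laplace_integrable lborel (partial_t m x) s"
        "laplace lborel (partial_t m x) s = (LBINT t:{0<..}. exp (- s * t) * J 1 x t)"
      using laplace_eq_open_half_line[OF int_J] pt by blast+
    have L_x: "laplace_integrable lborel (partial_x j m x) s"
        "laplace lborel (partial_x j m x) s =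
          (LBINT t:{0<..}. exp (- s * t) * ((-1) ^ j * H (Suc j) x t))" for j
      using laplace_eq_open_half_line[OF int_x] px[OF _ x] by blast+
    have "laplace lborel (partial_t m x) s = s * laplace lborel (m x) s - m x 0"
      unfolding L_m(2) L_t(2)
      using laplace_integral_of_derivative[OF H_continuous[OF x] J_cont C J_growth _ s, of 1]
        H_deriv_t[OF x, of _ 1] by (simp add: m0 H_zero)
    moreover have "(\<Sum>j=1..n. c j * laplace lborel (partial_x j m x) s) = laplace lborel (partial_t m x) s"
    proof -
      have "(\<Sum>j=1..n. c j * laplace lborel (partial_x j m x) s) =
          (\<integral>t. (\<Sum>j=1..n. c j * (indicator {0<..} t *\<^sub>R (exp (- s * t) * ((-1) ^ j * H (Suc j) x t)))) \<partial>lborel)"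
        unfolding L_x(2) set_lebesgue_integral_def
        by (subst Bochner_Integration.integral_sum)
           (simp_all only: integral_mult_right_zero integrable_mult_right int_x[unfolded set_integrable_def])
      also have "\<dots> = (LBINT t:{0<..}. exp (- s * t) * J 1 x t)"
        unfolding set_lebesgue_integral_def
      proof (intro Bochner_Integration.integral_cong refl)
        fix t :: real
        have "(\<Sum>j=1..n. c j * (indicator {0<..} t *\<^sub>R (exp (- s * t) * ((-1) ^ j * H (Suc j) x t)))) =
            indicator {0<..} t *\<^sub>R (exp (- s * t) * (\<Sum>j=1..n. c j * ((-1) ^ j * H (Suc j) x t)))"
          by (simp add: sum_distrib_left mult_ac)
        then show "(\<Sum>j=1..n. c j * (indicator {0<..} t *\<^sub>R (exp (- s * t) * ((-1) ^ j * H (Suc j) x t)))) =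
            indicator {0<..} t *\<^sub>R (exp (- s * t) * J 1 x t)"
          using J_eq[of t] by (cases "0 < t") simp_all
      qed
      finally show ?thesis
        by (simp add: L_t(2))
    qed
    ultimately show ?thesis
      using L_m(1) L_t(1) L_x(1) by (simp add: laplace_dirac_delta m0)
  qed
  show "(\<forall>t>0. (\<forall>j<n. (\<lambda>y. partial_x j m y t) differentiable at x) \<and> m x differentiable at t \<and>
         (\<Sum>j=1..n. (- 1) ^ j * real (n choose j) * \<mu> powr (1 - real j / real n)
             * partial_x j m x t)
         = partial_t m x t) \<and>
      (m x \<longlongrightarrow> m x 0) (at_right 0) \<and>
      (\<forall>s>0.
         laplace_integrable lborel (m x) s \<and>
         laplace_integrable lborel (partial_t m x) s \<and>
         (\<forall>j\<in>{1..n}. laplace_integrable lborel (partial_x j m x) s) \<and>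
         laplace lborel (partial_t m x) s = s * laplace lborel (m x) s - m x 0 \<and>
         (\<Sum>j=1..n. (- 1) ^ j * real (n choose j) * \<mu> powr (1 - real j / real n)
             * laplace lborel (partial_x j m x) s)
         = laplace lborel (partial_t m x) s + laplace dirac_delta (\<lambda>t. m x 0) s)"
    unfolding c_def[symmetric] using equation diff_x diff_t lim0 laplace_facts by (simp add: m0)
qed

end
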